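(* Let $A$ be a finite alphabet, let $K$ be a finitely generated subgroup of the free group $F_A$ with Stallings automaton $\mathcal S(K)=(Q,A,\delta,q_0)$, and let $S=(k_n)_{n\geq 1}$ be a sequence of positive integers. Let $\mathbf V_S$ be the pseudovariety of finite groups $G$ for which there exists $p\geq 1$ such that $G$ satisfies the identity $x^{k_n}=1$ for all $n\geq p$, and let $\overline{\mathbf V}_S$ be the class of all finite monoids all of whose subgroups belong to $\mathbf V_S$. The following conditions are equivalent: (i) $M(K)\in\overline{\mathbf V}_S$. (ii) There exists $p\geq 1$ such that for all $q\in Q$, $v\in\widetilde A^*$, $n\geq 1$ and $m\geq p$: if $q\cdot v^n=q$ then $q\cdot v^{(n,k_m)}=q$. (iii) There exists $p\geq 1$ such that for all $x\in F_A$, $n\geq 1$ and $m\geq p$: if $x^n\in K$ then $x^{(n,k_m)}\in K$. Here $(n,k_m)$ denotes the greatest common divisor of $n$ and $k_m$.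
   Context: Let $A^{-1}$ be the set of formal inverses of the letters of $A$ and $\widetilde A = A\cup A^{-1}$. Elements of $F_A$ are identified with reduced words in the free monoid $\widetilde A^*$. Stallings automaton. Let $K=\langle u_1,\dots,u_k\rangle\leq F_A$ be finitely generated, with the $u_i$ nonempty reduced words in $\widetilde A^*$. Take a basepoint $q_0$, attach to it $k$ closed paths (petals) labeled $u_1,\dots,u_k$ with otherwise disjoint new vertices, and add for every edge $p\xrightarrow{a}q$ ($a\in\widetilde A$) its inverse edge $q\xrightarrow{a^{-1}}p$. Then successively identify ("fold") pairs of distinct edges $p\xrightarrow{a}q$, $p\xrightarrow{a}r$ ($a\in\widetilde A$), together with their inverse edges (so $q$ and $r$ are merged), until the automaton is deterministic. The result, with $q_0$ as unique initial and terminal state, is the Stallings automaton $\mathcal S(K)=(Q,A,\delta,q_0)$; up to isomorphism it depends only on $K$ and $A$ (for $K=1$ it is the single vertex $q_0$ with no edges). For $q\in Q$ and $u\in\widetilde A^*$, $q\cdot u$ denotes the vertex reached by reading $u$ from $q$, if this is possible (otherwise it is undefined), and $\delta_u$ is the partial transformation $q\mapsto q\cdot u$ of $Q$. An equality $q\cdot u=q'$ means that $q\cdot u$ is defined and equals $q'$. The transition monoid is $M(K)=\{\delta_u \mid u\in\widetilde A^*\}$ under composition (left to right). A subgroup of a monoid $M$ is a subsemigroup of $M$ that is a group (its identity element need not be the identity of $M$). *)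

theory Defs
  imports "HOL-Algebra.Generated_Groups"
begin

section \<open>Free groups\<close>

text \<open>The letter \<open>(a, True)\<close> stands for \<open>a\<close> and \<open>(a, False)\<close> for its formal inverse.\<close>

type_synonym 'a letter = "'a \<times> bool"

definition letters :: "'a set \<Rightarrow> 'a letter set" where
  "letters A = A \<times> UNIV"

definition inv_letter :: "'a letter \<Rightarrow> 'a letter" where
  "inv_letter x = (fst x, \<not> snd x)"

definition reduced :: "'a letter list \<Rightarrow> bool" where
  "reduced w \<longleftrightarrow> successively (\<lambda>x y. y \<noteq> inv_letter x) w"

fun cons_reduce :: "'a letter \<Rightarrow> 'a letter list \<Rightarrow> 'a letter list" where
  "cons_reduce x [] = [x]"
| "cons_reduce x (y # w) = (if y = inv_letter x then w else x # y # w)"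

definition reduce :: "'a letter list \<Rightarrow> 'a letter list" where
  "reduce w = foldr cons_reduce w []"

definition free_group :: "'a set \<Rightarrow> 'a letter list monoid" where
  "free_group A =
     \<lparr>carrier = {w \<in> lists (letters A). reduced w},
      mult = (\<lambda>u v. reduce (u @ v)),
      one = []\<rparr>"

definition finitely_generated_subgroup :: "('g, 'x) monoid_scheme \<Rightarrow> 'g set \<Rightarrow> bool" where
  "finitely_generated_subgroup G K \<longleftrightarrow>
     subgroup K G \<and> (\<exists>X. finite X \<and> X \<subseteq> carrier G \<and> generate G X = K)"

definition word_power :: "'b list \<Rightarrow> nat \<Rightarrow> 'b list" where
  "word_power v n = concat (replicate n v)"

lemma inv_letter_inv [simp]: "inv_letter (inv_letter x) = x"
  by (simp add: inv_letter_def)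

lemma inv_letter_neq [simp]: "inv_letter x \<noteq> x" "x \<noteq> inv_letter x"
  by (simp_all add: inv_letter_def prod_eq_iff)

lemma inv_letter_in [simp]: "inv_letter x \<in> letters A \<longleftrightarrow> x \<in> letters A"
  by (cases x) (simp add: inv_letter_def letters_def)

lemma reduced_Nil [simp]: "reduced []"
  by (simp add: reduced_def)

lemma reduced_Cons: "reduced (x # w) \<longleftrightarrow> reduced w \<and> (w = [] \<or> hd w \<noteq> inv_letter x)"
  by (cases w) (auto simp: reduced_def)

lemma reduced_cons_reduce: "reduced w \<Longrightarrow> reduced (cons_reduce x w)"
  by (cases w) (auto simp: reduced_Cons)

lemma cons_reduce_cancel: "reduced w \<Longrightarrow> cons_reduce x (cons_reduce (inv_letter x) w) = w"
proof (cases w)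
  case (Cons y v)
  then show "reduced w \<Longrightarrow> ?thesis" by (cases v) (auto simp: reduced_Cons)
qed simp

lemma reduced_foldr: "reduced w \<Longrightarrow> reduced (foldr cons_reduce u w)"
  by (induction u) (auto intro: reduced_cons_reduce)

lemma reduced_reduce [simp]: "reduced (reduce w)"
  by (simp add: reduce_def reduced_foldr)

lemma reduce_reduced: "reduced w \<Longrightarrow> reduce w = w"
proof (induction w)
  case (Cons x w)
  then show ?case by (cases w) (auto simp: reduced_Cons reduce_def)
qed (simp add: reduce_def)

lemma reduce_append: "reduce (u @ v) = foldr cons_reduce u (reduce v)"
  by (simp add: reduce_def)

lemma foldr_cons_reduce:
  assumes "reduced w"
  shows "foldr cons_reduce (cons_reduce x u) w = cons_reduce x (foldr cons_reduce u w)"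
  using assms by (cases u) (auto simp: cons_reduce_cancel reduced_foldr)

lemma foldr_foldr:
  assumes "reduced w"
  shows "foldr cons_reduce (foldr cons_reduce u v) w = foldr cons_reduce u (foldr cons_reduce v w)"
  by (induction u) (simp_all add: foldr_cons_reduce[OF assms])

lemma foldr_reduce:
  assumes "reduced w"
  shows "foldr cons_reduce (reduce u) w = foldr cons_reduce u w"
  by (simp add: reduce_def foldr_foldr[OF assms])

lemma reduce_in_lists: "w \<in> lists L \<Longrightarrow> reduce w \<in> lists L"
proof (induction w)
  case (Cons x w)
  then have "reduce w \<in> lists L" "x \<in> L" by auto
  then show ?case by (cases "reduce w") (auto simp: reduce_def)
qed (simp add: reduce_def)

lemma foldr_inverse:
  assumes "reduced w"
  shows "foldr cons_reduce (rev (map inv_letter u)) (foldr cons_reduce u w) = w"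
  using assms
proof (induction u arbitrary: w)
  case (Cons x u)
  then show ?case
    using cons_reduce_cancel[of "foldr cons_reduce u w" "inv_letter x"]
    by (simp add: reduced_foldr)
qed simp

lemma group_free_group: "group (free_group A)"
proof (rule groupI)
  fix x y z
  assume "x \<in> carrier (free_group A)" "y \<in> carrier (free_group A)" "z \<in> carrier (free_group A)"
  then show "x \<otimes>\<^bsub>free_group A\<^esub> y \<otimes>\<^bsub>free_group A\<^esub> z
      = x \<otimes>\<^bsub>free_group A\<^esub> (y \<otimes>\<^bsub>free_group A\<^esub> z)"
    by (simp add: free_group_def reduce_append foldr_foldr reduce_reduced reduced_foldr)
next
  fix x assume x: "x \<in> carrier (free_group A)"
  let ?y = "reduce (rev (map inv_letter x))"
  have "?y \<in> carrier (free_group A)"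
    using x by (auto simp: free_group_def intro!: reduce_in_lists)
  moreover have "?y \<otimes>\<^bsub>free_group A\<^esub> x = \<one>\<^bsub>free_group A\<^esub>"
    using foldr_inverse[of "[]" x]
    by (simp add: free_group_def reduce_append foldr_reduce) (simp add: reduce_def)
  ultimately show "\<exists>y\<in>carrier (free_group A). y \<otimes>\<^bsub>free_group A\<^esub> x = \<one>\<^bsub>free_group A\<^esub>"
    by blast
qed (auto simp: free_group_def reduce_reduced intro!: reduce_in_lists)


section \<open>Stallings automata\<close>

text \<open>Edges form a set, so parallel edges with the same label are identified from the start; folding
  such a pair does not merge any vertices.\<close>

record ('q, 'a) automaton =
  verts :: "'q set"
  edges :: "('q \<times> 'a letter \<times> 'q) set"
  basepoint :: 'q

definition deterministic :: "('q, 'a) automaton \<Rightarrow> bool" where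
  "deterministic S \<longleftrightarrow>
     (\<forall>p x q r. (p, x, q) \<in> edges S \<longrightarrow> (p, x, r) \<in> edges S \<longrightarrow> q = r)"

datatype flower_vertex = Base | Inner nat nat

text \<open>\<open>petal_vertex us i j\<close> is the vertex reached after reading the first \<open>j\<close> letters of the
  petal labeled \<open>us ! i\<close>.\<close>

definition petal_vertex :: "'a letter list list \<Rightarrow> nat \<Rightarrow> nat \<Rightarrow> flower_vertex" where
  "petal_vertex us i j = (if j = 0 \<or> j = length (us ! i) then Base else Inner i j)"

definition petal_edges ::
  "'a letter list list \<Rightarrow> (flower_vertex \<times> 'a letter \<times> flower_vertex) set" where
  "petal_edges us =
     {(petal_vertex us i j, us ! i ! j, petal_vertex us i (Suc j)) | i j.
        i < length us \<and> j < length (us ! i)}"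

definition flower :: "'a letter list list \<Rightarrow> (flower_vertex, 'a) automaton" where
  "flower us =
     \<lparr>verts = {Base} \<union> {Inner i j | i j. i < length us \<and> 0 < j \<and> j < length (us ! i)},
      edges = petal_edges us \<union> {(q, inv_letter x, p) | p x q. (p, x, q) \<in> petal_edges us},
      basepoint = Base\<rparr>"

text \<open>\<open>merge q r S\<close> is the quotient of \<open>S\<close> that identifies \<open>r\<close> with \<open>q\<close>; the merged vertex keeps
  the name \<open>q\<close>.\<close>

definition merge :: "'q \<Rightarrow> 'q \<Rightarrow> ('q, 'a) automaton \<Rightarrow> ('q, 'a) automaton" where
  "merge q r S =
     (let f = id(r := q) in
      \<lparr>verts = f ` verts S,
       edges = (\<lambda>(s, x, t). (f s, x, f t)) ` edges S,
       basepoint = f (basepoint S)\<rparr>)"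

inductive fold_step :: "('q, 'a) automaton \<Rightarrow> ('q, 'a) automaton \<Rightarrow> bool" where
  "(p, x, q) \<in> edges S \<Longrightarrow> (p, x, r) \<in> edges S \<Longrightarrow> q \<noteq> r \<Longrightarrow> fold_step S (merge q r S)"

text \<open>The Stallings automaton is only determined up to isomorphism, hence a predicate: it holds for
  the outcome of every complete folding sequence, for every choice of generators.\<close>

definition is_stallings_automaton ::
  "'a set \<Rightarrow> 'a letter list set \<Rightarrow> (flower_vertex, 'a) automaton \<Rightarrow> bool" where
  "is_stallings_automaton A K S \<longleftrightarrow>
     (\<exists>us. set us \<subseteq> carrier (free_group A) - {[]} \<and>
           generate (free_group A) (set us) = K \<and>
           fold_step\<^sup>*\<^sup>* (flower us) S \<and> deterministic S)"

lemma fold_terminates: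
  assumes "finite (verts S)"
    and "\<And>p x q. (p, x, q) \<in> edges S \<Longrightarrow> p \<in> verts S \<and> q \<in> verts S"
  shows "\<exists>T. fold_step\<^sup>*\<^sup>* S T \<and> deterministic T"
  using assms
proof (induction "card (verts S)" arbitrary: S rule: less_induct)
  case less
  show ?case
  proof (cases "deterministic S")
    case False
    then obtain p x q r where e: "(p, x, q) \<in> edges S" "(p, x, r) \<in> edges S" "q \<noteq> r"
      by (auto simp: deterministic_def)
    let ?T = "merge q r S"
    have qr: "q \<in> verts S" "r \<in> verts S" using less.prems(2) e by blast+
    have "verts ?T = verts S - {r}"
      using qr e(3) by (auto simp: merge_def Let_def image_iff)
    then have card: "card (verts ?T) < card (verts S)" and fin: "finite (verts ?T)"
      using qr less.prems(1) by (simp_all only: card_Diff1_less finite_Diff)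
    have closed: "p' \<in> verts ?T \<and> q' \<in> verts ?T" if edge: "(p', x', q') \<in> edges ?T" for p' x' q'
    proof -
      obtain s t where "(s, x', t) \<in> edges S" "p' = (id(r := q)) s" "q' = (id(r := q)) t"
        using edge by (auto simp add: merge_def Let_def simp del: fun_upd_apply)
      then show ?thesis
        using less.prems(2)[of s x' t] unfolding merge_def Let_def automaton.simps by blast
    qed
    obtain T where T: "fold_step\<^sup>*\<^sup>* ?T T" "deterministic T"
      using less.hyps[OF card fin] closed by metis
    have "fold_step S ?T"
      using e by (rule fold_step.intros)
    then show ?thesis
      using T converse_rtranclp_into_rtranclp[of fold_step] by blast
  next
    case True
    then show ?thesis by blast
  qed
qed

lemma ex_stallings_automaton:
  assumes "finitely_generated_subgroup (free_group A) K"
  shows "\<exists>S. is_stallings_automaton A K S"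
proof -
  obtain X where X: "finite X" "X \<subseteq> carrier (free_group A)" "generate (free_group A) X = K"
    using assms by (auto simp: finitely_generated_subgroup_def)
  interpret group "free_group A" by (rule group_free_group)
  obtain us where us: "set us = X - {[]}"
    using X(1) finite_list[of "X - {[]}"] by auto
  have sub: "subgroup (generate (free_group A) (X - {[]})) (free_group A)"
    using X(2) by (intro generate_is_subgroup) auto
  have "X \<subseteq> generate (free_group A) (X - {[]})"
  proof
    fix x assume "x \<in> X"
    then show "x \<in> generate (free_group A) (X - {[]})"
      using subgroup.one_closed[OF sub]
      by (cases "x = []") (auto simp: free_group_def intro: generate.incl)
  qed
  then have gen: "generate (free_group A) (X - {[]}) = K"
    using X generate_subgroup_incl[OF _ sub] mono_generate[of "X - {[]}" X] by blast
  let ?I = "(\<lambda>(i, j). Inner i j) ` (SIGMA i:{..<length us}. {..<length (us ! i)})"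
  have "verts (flower us) \<subseteq> insert Base ?I"
    by (auto simp: flower_def)
  then have "finite (verts (flower us))"
    by (rule finite_subset) auto
  moreover have "p \<in> verts (flower us) \<and> q \<in> verts (flower us)" if edge: "(p, x, q) \<in> edges (flower us)"
    for p x q
  proof -
    have "petal_vertex us i j \<in> verts (flower us)" if "i < length us" "j \<le> length (us ! i)" for i j
      using that by (auto simp: flower_def petal_vertex_def)
    moreover obtain i j where "i < length us" "j < length (us ! i)"
      "p = petal_vertex us i j \<and> q = petal_vertex us i (Suc j) \<or>
       q = petal_vertex us i j \<and> p = petal_vertex us i (Suc j)"
    proof -
      consider "(p, x, q) \<in> petal_edges us" | y where "(q, y, p) \<in> petal_edges us"
        using edge unfolding flower_def by auto
      then show thesis
        by cases (auto simp: petal_edges_def intro: that)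
    qed
    ultimately show ?thesis by (metis Suc_leI less_imp_le)
  qed
  ultimately obtain T where "fold_step\<^sup>*\<^sup>* (flower us) T" "deterministic T"
    using fold_terminates by blast
  then show ?thesis
    using us gen X(2) unfolding is_stallings_automaton_def
    by (intro exI[of _ T] exI[of _ us]) auto
qed


section \<open>The transition monoid\<close>

text \<open>The description operator is only used for deterministic automata, where the target is
  unique.\<close>

definition step :: "('q, 'a) automaton \<Rightarrow> 'q \<Rightarrow> 'a letter \<Rightarrow> 'q option" where
  "step S p x = (if \<exists>q. (p, x, q) \<in> edges S then Some (THE q. (p, x, q) \<in> edges S) else None)"

fun run :: "('q, 'a) automaton \<Rightarrow> 'a letter list \<Rightarrow> 'q \<Rightarrow> 'q option" where
  "run S [] p = (if p \<in> verts S then Some p else None)"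
| "run S (x # u) p = Option.bind (step S p x) (run S u)"

text \<open>Partial transformations of the vertex set are functions into the option type that are
  \<open>None\<close> outside the vertex set; \<open>run S u\<close> is the transformation induced by \<open>u\<close>.\<close>

definition transition_monoid :: "'a set \<Rightarrow> ('q, 'a) automaton \<Rightarrow> ('q \<Rightarrow> 'q option) monoid" where
  "transition_monoid A S =
     \<lparr>carrier = {run S u | u. u \<in> lists (letters A)},
      mult = (\<lambda>f g q. Option.bind (f q) g),
      one = run S []\<rparr>"


section \<open>Pseudovarieties\<close>

text \<open>A subgroup of a monoid is given with its identity \<open>e\<close>, which need not be the identity of the
  monoid. The class \<open>group\<close> includes closure under multiplication.\<close>

definition subgroup_of_monoid :: "'m monoid \<Rightarrow> 'm monoid \<Rightarrow> bool" where
  "subgroup_of_monoid H M \<longleftrightarrow>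
     (\<exists>e. carrier H \<subseteq> carrier M \<and> H = M\<lparr>carrier := carrier H, one := e\<rparr> \<and> group H)"

definition V :: "(nat \<Rightarrow> nat) \<Rightarrow> 'g monoid set" where
  "V k = {G. group G \<and> finite (carrier G) \<and>
     (\<exists>p\<ge>1. \<forall>n\<ge>p. \<forall>x\<in>carrier G. x [^]\<^bsub>G\<^esub> k n = \<one>\<^bsub>G\<^esub>)}"

definition V_bar :: "(nat \<Rightarrow> nat) \<Rightarrow> 'm monoid set" where
  "V_bar k = {M. monoid M \<and> finite (carrier M) \<and> (\<forall>H. subgroup_of_monoid H M \<longrightarrow> H \<in> V k)}"

end

theory Submission
  imports Defs "HOL-Algebra.Multiplicative_Group"
begin

text \<open>In a Stallings automaton every letter acts as a partial injection, and a vertex \<open>q\<close> fixed by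
  \<open>v\<^sup>n\<close> and by \<open>v\<^sup>k\<close> is fixed by \<open>v\<^bsup>gcd(n,k)\<^esup>\<close>. If the subgroups of the transition monoid
  satisfy \<open>x\<^sup>k = 1\<close>, applying this to the cyclic group of all high powers of \<open>\<delta>\<^sub>v\<close> shows that
  \<open>v\<^sup>n\<close> fixing \<open>q\<close> forces \<open>v\<^sup>k\<close> to fix \<open>q\<close>; finiteness of the monoid makes the threshold uniform in \<open>v\<close>.
  Conversely, an element of a subgroup \<open>H\<close> raised to the order of \<open>H\<close> fixes every vertex of its
  domain. Vertices and \<open>K\<close> are related by \<open>q = q\<^sub>0 \<cdot> z\<close> and \<open>x = z y z\<^sup>-\<^sup>1\<close>, with \<open>y\<close> cyclically reduced
  so that \<open>z y\<^sup>n z\<^sup>-\<^sup>1\<close> is reduced and can be read from \<open>q\<^sub>0\<close> as soon as it lies in \<open>K\<close>.\<close>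

section \<open>Words and the free group\<close>

definition inv_word :: "'a letter list \<Rightarrow> 'a letter list" where
  "inv_word w = rev (map inv_letter w)"

lemma inv_word_simps [simp]:
  "inv_word [] = []" "inv_word (x # w) = inv_word w @ [inv_letter x]"
  "inv_word (u @ v) = inv_word v @ inv_word u"
  by (simp_all add: inv_word_def)

lemma inv_word_in_lists: "w \<in> lists (letters A) \<Longrightarrow> inv_word w \<in> lists (letters A)"
  by (auto simp: inv_word_def)

lemma word_power_0 [simp]: "word_power v 0 = []"
  and word_power_Suc: "word_power v (Suc n) = v @ word_power v n"
  and word_power_add: "word_power v (m + n) = word_power v m @ word_power v n"
  by (simp_all add: word_power_def replicate_add)

lemma word_power_in_lists: "v \<in> lists L \<Longrightarrow> word_power v n \<in> lists L"
  by (induction n) (simp_all add: word_power_Suc)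

lemma free_group_sel [simp]:
  "carrier (free_group A) = {w \<in> lists (letters A). reduced w}"
  "\<one>\<^bsub>free_group A\<^esub> = []"
  "u \<otimes>\<^bsub>free_group A\<^esub> v = reduce (u @ v)"
  by (simp_all add: free_group_def)

lemma reduce_Nil [simp]: "reduce [] = []"
  by (simp add: reduce_def)

lemma reduce_append_reduce: "reduce (reduce u @ reduce v) = reduce (u @ v)"
  by (simp add: reduce_append foldr_reduce reduce_reduced)

lemma reduce_append_reduce_left: "reduce (reduce u @ v) = reduce (u @ v)"
  by (simp add: reduce_append foldr_reduce)

lemma reduce_append_reduce_right: "reduce (u @ reduce v) = reduce (u @ v)"
  by (simp add: reduce_append reduce_reduced)

lemma reduce_inv_word: "reduce (inv_word u @ u) = []"
  using foldr_inverse[of "[]" u] by (simp add: reduce_append inv_word_def) (simp add: reduce_def)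

lemma inv_free_group:
  assumes "w \<in> carrier (free_group A)"
  shows "inv\<^bsub>free_group A\<^esub> w = reduce (inv_word w)"
proof -
  interpret group "free_group A" by (rule group_free_group)
  show ?thesis
    using assms by (intro inv_equality)
      (auto simp: reduce_append_reduce_left reduce_inv_word intro!: reduce_in_lists inv_word_in_lists)
qed

text \<open>Adjacent factors \<open>inv_word u @ u\<close> cancel. Stated for arbitrary words, to
  cover conjugation by the label of any path from the basepoint.\<close>

lemma reduce_conj_power:
  "reduce (word_power (u @ v @ inv_word u) n) = reduce (u @ word_power v n @ inv_word u)"
proof (induction n)
  case 0
  \<comment> \<open>The cancellation rule is applied to \<open>inv_word u\<close>, whose own inverse
    word is \<open>u\<close>.\<close>
  show ?case
    using reduce_inv_word[of "inv_word u"]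
    by (simp add: inv_word_def rev_map o_def)
next
  case (Suc n)
  have "reduce (word_power (u @ v @ inv_word u) (Suc n))
      = reduce (u @ v @ reduce ((inv_word u @ u) @ word_power v n @ inv_word u))"
    using Suc reduce_append_reduce_right[of "u @ v @ inv_word u"]
    by (metis append.assoc reduce_append_reduce_right word_power_Suc)
  also have "reduce ((inv_word u @ u) @ word_power v n @ inv_word u) =
      reduce (word_power v n @ inv_word u)"
    by (metis append_Nil reduce_append_reduce_left reduce_inv_word)
  also have "reduce (u @ v @ reduce (word_power v n @ inv_word u)) =
      reduce (u @ word_power v (Suc n) @ inv_word u)"
    by (metis append.assoc reduce_append_reduce_right word_power_Suc)
  finally show ?case .
qed

lemma pow_free_group: "reduce w [^]\<^bsub>free_group A\<^esub> (n::nat) = reduce (word_power w n)"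
proof (induction n)
  case (Suc n)
  have "word_power w (Suc n) = word_power w n @ w"
    using word_power_add[of w n 1] by (simp add: word_power_Suc)
  with Suc show ?case
    by (simp add: nat_pow_def reduce_append_reduce)
qed (simp add: nat_pow_def)

text \<open>Mutually inverse outer letters are stripped off pair by pair. The condition
  \<open>reduced (y @ y)\<close> expresses that \<open>y\<close> is cyclically reduced.\<close>

lemma cyclic_reduction:
  assumes "reduced x" "x \<noteq> []"
  obtains z y where "x = z @ y @ inv_word z" "y \<noteq> []" "reduced (y @ y)"
  using assms
proof (induction "length x" arbitrary: x thesis rule: less_induct)
  case less
  show ?case
  proof (cases "last x = inv_letter (hd x)")
    case False
    have "reduced (x @ x)"
      using less.prems False by (auto simp: reduced_def successively_append_iff)
    then show ?thesis
      using less.prems(1)[of "[]" x] less.prems by simp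
  next
    case True
    \<comment> \<open>A letter is never its own inverse, so \<open>x\<close> has at least two
      letters here.\<close>
    obtain a t where t: "x = a # t" "t \<noteq> []"
      using less.prems True by (cases x) (auto split: if_splits)
    obtain m where "t = m @ [inv_letter a]"
      using t True by (metis append_butlast_last_id last_ConsR list.sel(1))
    with t have x: "x = a # m @ [inv_letter a]" by simp
    \<comment> \<open>Otherwise \<open>x\<close> would be a letter followed by its inverse, which is
      not reduced.\<close>
    have "m \<noteq> []"
      using less.prems(2) x by (auto simp: reduced_Cons)
    moreover have "reduced m"
      using less.prems(2) x by (auto simp: reduced_def successively_append_iff successively_Cons)
    ultimately obtain z y where "m = z @ y @ inv_word z" "y \<noteq> []" "reduced (y @ y)"
      using less.hyps[of m] x by auto
    then show ?thesis
      using less.prems(1)[of "a # z" y] x by simp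
  qed
qed

lemma word_power_eq_Nil_iff [simp]: "word_power y n = [] \<longleftrightarrow> n = 0 \<or> y = []"
  by (auto simp: word_power_def)

lemma hd_word_power: "y \<noteq> [] \<Longrightarrow> n \<ge> 1 \<Longrightarrow> hd (word_power y n) = hd y"
  by (cases n) (auto simp: word_power_Suc)

lemma last_word_power: "y \<noteq> [] \<Longrightarrow> n \<ge> 1 \<Longrightarrow> last (word_power y n) = last y"
  by (induction n) (auto simp: word_power_Suc last_append)

lemma reduced_word_power:
  assumes "reduced (y @ y)" "y \<noteq> []"
  shows "reduced (word_power y n)"
proof (induction n)
  case (Suc n)
  with assms hd_word_power[of y n] show ?case
    by (cases n) (auto simp: reduced_def successively_append_iff word_power_Suc)
qed simp

text \<open>A positive power of \<open>y\<close> starts and ends with the same letters as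
  \<open>y\<close>, so its junctions with \<open>z\<close> and \<open>inv_word z\<close> are those
  of the given reduced word. For \<open>n = 0\<close> inverse letters could meet in the
  middle.\<close>

lemma reduced_conj_power:
  assumes "reduced (z @ y @ inv_word z)" "reduced (y @ y)" "y \<noteq> []" "n \<ge> 1"
  shows "reduced (z @ word_power y n @ inv_word z)"
  using assms reduced_word_power[of y n] hd_word_power[of y n] last_word_power[of y n]
  by (auto simp: reduced_def successively_append_iff)


section \<open>Paths and folding\<close>

text \<open>Relational counterpart of \<open>run\<close>, meaningful also for the nondeterministic
  automata met during folding. The empty path exists at every point, vertex or not.\<close>

fun path :: "('q, 'a) automaton \<Rightarrow> 'q \<Rightarrow> 'a letter list \<Rightarrow> 'q \<Rightarrow> bool" where
  "path S p [] q \<longleftrightarrow> p = q"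
| "path S p (x # w) q \<longleftrightarrow> (\<exists>r. (p, x, r) \<in> edges S \<and> path S r w q)"

lemma path_append: "path S p (u @ v) q \<longleftrightarrow> (\<exists>r. path S p u r \<and> path S r v q)"
  by (induction u arbitrary: p) auto

lemma merge_sel [simp]:
  "verts (merge q r S) = (id(r := q)) ` verts S"
  "edges (merge q r S) = (\<lambda>(s, x, t). ((id(r := q)) s, x, (id(r := q)) t)) ` edges S"
  "basepoint (merge q r S) = (id(r := q)) (basepoint S)"
  by (simp_all add: merge_def Let_def del: fun_upd_apply)

lemma path_merge:
  "path S p w t \<Longrightarrow> path (merge q r S) ((id(r := q)) p) w ((id(r := q)) t)"
proof (induction w arbitrary: p)
  case (Cons x w)
  then obtain s where s: "(p, x, s) \<in> edges S" "path S s w t" by auto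
  have "((id(r := q)) p, x, (id(r := q)) s) \<in> edges (merge q r S)"
    using s(1) unfolding merge_sel by force
  then show ?case using Cons.IH[OF s(2)] unfolding path.simps by blast
qed simp

text \<open>These properties hold for the flower and survive every merge; determinism is added only
  once folding is complete.\<close>

locale inverse_automaton =
  fixes A :: "'a set" and S :: "('q, 'a) automaton"
  assumes finite_verts: "finite (verts S)"
    and basepoint_in: "basepoint S \<in> verts S"
    and edges_closed: "(p, x, q) \<in> edges S \<Longrightarrow> p \<in> verts S \<and> x \<in> letters A \<and> q \<in> verts S"
    and edges_inv: "(p, x, q) \<in> edges S \<Longrightarrow> (q, inv_letter x, p) \<in> edges S"
    and connected: "q \<in> verts S \<Longrightarrow> \<exists>u. path S (basepoint S) u q"
begin

lemma path_in_verts: "path S p w q \<Longrightarrow> p \<in> verts S \<Longrightarrow> q \<in> verts S"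
  by (induction w arbitrary: p) (auto dest: edges_closed)

lemma path_in_lists: "path S p w q \<Longrightarrow> w \<in> lists (letters A)"
  by (induction w arbitrary: p) (auto dest: edges_closed)

lemma path_inv: "path S p w q \<Longrightarrow> path S q (inv_word w) p"
  by (induction w arbitrary: p) (auto simp: path_append dest: edges_inv)

lemma inverse_automaton_merge: "inverse_automaton A (merge q r S)"
proof
  let ?f = "id(r := q)"
  show "finite (verts (merge q r S))" using finite_verts by simp
  show "basepoint (merge q r S) \<in> verts (merge q r S)"
    using basepoint_in unfolding merge_sel by blast
  fix p x t assume "(p, x, t) \<in> edges (merge q r S)"
  then obtain p' t' where e: "(p', x, t') \<in> edges S" "p = ?f p'" "t = ?f t'"
    by (auto simp del: fun_upd_apply)
  show "p \<in> verts (merge q r S) \<and> x \<in> letters A \<and> t \<in> verts (merge q r S)"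
    using edges_closed[OF e(1)] e(2,3) unfolding merge_sel by blast
  show "(t, inv_letter x, p) \<in> edges (merge q r S)"
    using edges_inv[OF e(1)] e(2,3) unfolding merge_sel by force
next
  fix t assume "t \<in> verts (merge q r S)"
  then obtain t' where "t' \<in> verts S" "t = (id(r := q)) t'"
    unfolding merge_sel by blast
  then show "\<exists>u. path (merge q r S) (basepoint (merge q r S)) u t"
    using connected[of t'] path_merge unfolding merge_sel(3) by metis
qed

end

text \<open>A morphism into the Schreier graph of the right cosets of \<open>K\<close>. It serves to
  show that reduced labels of closed paths at the basepoint lie in \<open>K\<close>.\<close>

definition coset_labelling ::
  "'a set \<Rightarrow> 'a letter list set \<Rightarrow> ('q, 'a) automaton \<Rightarrow> ('q \<Rightarrow> 'a letter list set) \<Rightarrow> bool" where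
  "coset_labelling A K S c \<longleftrightarrow>
     c (basepoint S) = K \<and>
     (\<forall>p x q. (p, x, q) \<in> edges S \<longrightarrow> c q = c p #>\<^bsub>free_group A\<^esub> [x])"

text \<open>Two vertices that get identified carry the same coset, so the labelling itself survives
  folding unchanged.\<close>

lemma coset_labelling_merge:
  assumes "coset_labelling A K S c" "(p, x, q) \<in> edges S" "(p, x, r) \<in> edges S"
  shows "coset_labelling A K (merge q r S) c"
proof -
  have "c q = c r" using assms unfolding coset_labelling_def by metis
  then have "c ((id(r := q)) s) = c s" for s by simp
  then show ?thesis
    using assms(1) by (auto simp: coset_labelling_def simp del: fun_upd_apply)
qed

text \<open>The labelling will bound the set of reduced closed labels at the basepoint by
  \<open>K\<close> from above; the surviving closed paths, among them the petals, will bound it from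
  below.\<close>

lemma fold_steps_invariants:
  assumes "fold_step\<^sup>*\<^sup>* S T" "inverse_automaton A S" "coset_labelling A K S c"
  shows "inverse_automaton A T \<and> coset_labelling A K T c \<and>
    (\<forall>w. path S (basepoint S) w (basepoint S) \<longrightarrow> path T (basepoint T) w (basepoint T))"
  using assms
proof (induction rule: rtranclp_induct)
  case (step T U)
  from step(2) show ?case
  proof cases
    case (1 p x q r)
    then show ?thesis
      using step inverse_automaton.inverse_automaton_merge[of A T q r]
        coset_labelling_merge[of A K T c p x q r] path_merge[of T "basepoint T" _ "basepoint T" q r]
      by (simp del: fun_upd_apply)
  qed
qed simp

text \<open>Each edge multiplies the coset by its letter. The reduction appears because a path may
  backtrack, whereas group elements are reduced words.\<close>

lemma path_coset:
  assumes "coset_labelling A K S c" "path S p w q" "w \<in> lists (letters A)"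
    "c p \<subseteq> carrier (free_group A)"
  shows "c q = c p #>\<^bsub>free_group A\<^esub> reduce w"
proof -
  interpret group "free_group A" by (rule group_free_group)
  show ?thesis
    using assms(2-)
  proof (induction w arbitrary: p)
    case Nil
    then show ?case using coset_mult_one[of "c p"] by simp
  next
    case (Cons x w)
    then obtain r where r: "(p, x, r) \<in> edges S" "path S r w q" by auto
    have x: "[x] \<in> carrier (free_group A)" and w: "reduce w \<in> carrier (free_group A)"
      using Cons.prems by (auto simp: reduced_Cons intro!: reduce_in_lists)
    have cr: "c r = c p #>\<^bsub>free_group A\<^esub> [x]"
      using assms(1) r(1) unfolding coset_labelling_def by blast
    have "c q = c r #>\<^bsub>free_group A\<^esub> reduce w"
      using Cons.IH[OF r(2)] Cons.prems cr r_coset_subset_G[OF Cons.prems(3) x] by simp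
    also have "\<dots> = c p #>\<^bsub>free_group A\<^esub> ([x] \<otimes>\<^bsub>free_group A\<^esub> reduce w)"
      unfolding cr using coset_mult_assoc[OF Cons.prems(3) x w] .
    also have "[x] \<otimes>\<^bsub>free_group A\<^esub> reduce w = reduce (x # w)"
      using reduce_append_reduce_right[of "[x]" w] by simp
    finally show ?case .
  qed
qed

section \<open>The flower automaton\<close>

lemma inv_edges_flower:
  "(p, x, q) \<in> edges (flower us) \<Longrightarrow> (q, inv_letter x, p) \<in> edges (flower us)"
  unfolding flower_def by auto (metis surj_pair)+

lemma petal_edge:
  "i < length us \<Longrightarrow> j < length (us ! i) \<Longrightarrow>
   (petal_vertex us i j, us ! i ! j, petal_vertex us i (Suc j)) \<in> edges (flower us)"
  by (auto simp: flower_def petal_edges_def)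

lemma petal_path:
  "i < length us \<Longrightarrow> j \<le> length (us ! i) \<Longrightarrow>
   path (flower us) Base (take j (us ! i)) (petal_vertex us i j)"
proof (induction j)
  case (Suc j)
  then show ?case
    using petal_edge[of i us j] by (auto simp: take_Suc_conv_app_nth path_append)
qed (simp add: petal_vertex_def)

lemma basepoint_flower [simp]: "basepoint (flower us) = Base"
  by (simp add: flower_def)

lemma path_flower: "u \<in> set us \<Longrightarrow> path (flower us) Base u Base"
  by (metis in_set_conv_nth le_refl petal_path petal_vertex_def take_all)

lemma flower_edge_cases:
  assumes "(p, x, q) \<in> edges (flower us)"
  obtains i j where "i < length us" "j < length (us ! i)"
      "p = petal_vertex us i j" "x = us ! i ! j" "q = petal_vertex us i (Suc j)"
    | i j where "i < length us" "j < length (us ! i)"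
      "q = petal_vertex us i j" "x = inv_letter (us ! i ! j)" "p = petal_vertex us i (Suc j)"
  using assms by (auto simp: flower_def petal_edges_def)

lemma petal_vertex_in:
  "i < length us \<Longrightarrow> j \<le> length (us ! i) \<Longrightarrow> petal_vertex us i j \<in> verts (flower us)"
  by (auto simp: flower_def petal_vertex_def)

lemma inverse_automaton_flower:
  assumes "set us \<subseteq> lists (letters A)"
  shows "inverse_automaton A (flower us)"
proof
  let ?I = "(\<lambda>(i, j). Inner i j) ` (SIGMA i:{..<length us}. {..<length (us ! i)})"
  have "verts (flower us) \<subseteq> insert Base ?I"
    by (auto simp: flower_def)
  then show "finite (verts (flower us))"
    by (rule finite_subset) auto
  show "basepoint (flower us) \<in> verts (flower us)"
    by (simp add: flower_def)
  have letter: "us ! i ! j \<in> letters A" if "i < length us" "j < length (us ! i)" for i j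
    using assms that nth_mem by (metis in_lists_conv_set subsetD)
  fix p x q assume "(p, x, q) \<in> edges (flower us)"
  then show "p \<in> verts (flower us) \<and> x \<in> letters A \<and> q \<in> verts (flower us)"
    by (cases rule: flower_edge_cases) (simp_all add: petal_vertex_in letter)
next
  fix q assume "q \<in> verts (flower us)"
  then consider "q = Base" | i j where "i < length us" "0 < j" "j < length (us ! i)" "q = Inner i j"
    by (auto simp: flower_def)
  then show "\<exists>u. path (flower us) (basepoint (flower us)) u q"
  proof cases
    case 1
    then have "path (flower us) (basepoint (flower us)) [] q" by simp
    then show ?thesis ..
  next
    case 2
    then show ?thesis using petal_path[of i us j] by (auto simp: petal_vertex_def)
  qed
qed (rule inv_edges_flower)

text \<open>A petal vertex is labelled by the coset of the prefix leading to it. This is consistent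
  at the end of the petal because its whole label lies in \<open>K\<close>.\<close>

lemma coset_labelling_flower:
  assumes us: "set us \<subseteq> carrier (free_group A)" and K: "subgroup K (free_group A)" "set us \<subseteq> K"
  shows "\<exists>c. coset_labelling A K (flower us) c"
proof -
  interpret group "free_group A" by (rule group_free_group)
  let ?G = "free_group A"
  define c where "c q = (case q of Base \<Rightarrow> K | Inner i j \<Rightarrow> K #>\<^bsub>?G\<^esub> take j (us ! i))" for q
  have KG: "K \<subseteq> carrier ?G" using K(1) by (rule subgroup.subset)
  have petal: "us ! i \<in> carrier ?G" "us ! i \<in> K" if "i < length us" for i
    using that us K(2) nth_mem by blast+
  have prefix: "take j (us ! i) \<in> carrier ?G" if "i < length us" for i j
  proof -
    have "reduced (take j (us ! i) @ drop j (us ! i))" "take j (us ! i) @ drop j (us ! i) \<in> lists (letters A)"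
      using petal(1)[OF that] by simp_all
    then show ?thesis
      by (simp only: reduced_def successively_append_iff append_in_lists_conv free_group_sel) simp
  qed
  \<comment> \<open>Both ends of the petal are \<open>Base\<close>: the empty prefix is settled by
    \<open>coset_mult_one\<close>, the full one by \<open>coset_join2\<close>.\<close>
  have c: "c (petal_vertex us i j) = K #>\<^bsub>?G\<^esub> take j (us ! i)"
    if "i < length us" for i j
    using coset_mult_one[OF KG] coset_join2[OF petal(1)[OF that] K(1) petal(2)[OF that]]
    by (auto simp: c_def petal_vertex_def)
  have letter: "[us ! i ! j] \<in> carrier ?G" if "i < length us" "j < length (us ! i)" for i j
    using petal(1)[OF that(1)] that(2) by (auto simp: reduced_Cons)
  have next_vertex: "c (petal_vertex us i (Suc j)) = c (petal_vertex us i j) #>\<^bsub>?G\<^esub> [us ! i ! j]"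
    if "i < length us" "j < length (us ! i)" for i j
  proof -
    have "take j (us ! i) \<otimes>\<^bsub>?G\<^esub> [us ! i ! j] = take (Suc j) (us ! i)"
      using that prefix[OF that(1), of "Suc j"] by (simp add: take_Suc_conv_app_nth reduce_reduced)
    then show ?thesis
      using coset_mult_assoc[OF KG prefix[OF that(1), of j] letter[OF that]] that by (simp add: c)
  qed
  have "c q = c p #>\<^bsub>?G\<^esub> [x]" if "(p, x, q) \<in> edges (flower us)" for p x q
    using that
  proof (cases rule: flower_edge_cases)
    case (1 i j)
    then show ?thesis by (simp add: next_vertex)
  next
    case (2 i j)
    have x: "[us ! i ! j] \<in> carrier ?G" "[x] \<in> carrier ?G"
      using letter[of i j] 2 by (auto simp: reduced_Cons)
    have cq: "c q \<subseteq> carrier ?G"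
      using 2 c r_coset_subset_G[OF KG prefix[of i j]] by simp
    \<comment> \<open>The edge runs backwards along the petal, so \<open>c p\<close> arises from
      \<open>c q\<close> by the letter that \<open>x\<close> cancels.\<close>
    have "c p #>\<^bsub>?G\<^esub> [x] = c q #>\<^bsub>?G\<^esub> ([us ! i ! j] \<otimes>\<^bsub>?G\<^esub> [x])"
      using 2 coset_mult_assoc[OF cq x] by (simp add: next_vertex)
    also have "[us ! i ! j] \<otimes>\<^bsub>?G\<^esub> [x] = \<one>\<^bsub>?G\<^esub>"
      using 2 by (simp add: reduce_def)
    finally show ?thesis using coset_mult_one[OF cq] by simp
  qed
  moreover have "c (basepoint (flower us)) = K"
    by (simp add: c_def)
  ultimately show ?thesis unfolding coset_labelling_def by blast
qed


section \<open>Stallings automata\<close>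

locale det_inverse_automaton = inverse_automaton +
  assumes det: "deterministic S"
begin

lemma path_unique: "path S p w q \<Longrightarrow> path S p w r \<Longrightarrow> q = r"
  using det by (induction w arbitrary: p) (auto simp: deterministic_def, metis)

text \<open>Reading \<open>w\<close> backwards from \<open>r\<close> turns determinism into
  injectivity.\<close>

lemma path_injective: "path S p w r \<Longrightarrow> path S q w r \<Longrightarrow> p = q"
  by (meson path_inv path_unique)

text \<open>By determinism, an edge followed by one with the inverse letter returns to its start, so
  cancelling the two letters keeps the endpoint.\<close>

lemma path_reduce: "path S p w q \<Longrightarrow> path S p (reduce w) q"
proof (induction w arbitrary: p)
  case (Cons x w)
  then obtain r where r: "(p, x, r) \<in> edges S" "path S r (reduce w) q" by auto
  have red: "reduce (x # w) = cons_reduce x (reduce w)"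
    by (simp add: reduce_def)
  show ?case
  proof (cases "\<exists>w'. reduce w = inv_letter x # w'")
    case True
    then obtain w' where w': "reduce w = inv_letter x # w'" by blast
    with r obtain s where s: "(r, inv_letter x, s) \<in> edges S" "path S s w' q" by auto
    have "s = p" using s(1) edges_inv[OF r(1)] det unfolding deterministic_def by blast
    then show ?thesis using s(2) red w' by simp
  next
    case False
    then have "reduce (x # w) = x # reduce w"
      unfolding red by (cases "reduce w") auto
    then show ?thesis using r by auto
  qed
qed simp

lemma path_power_mult: "path S q (word_power v n) q \<Longrightarrow> path S q (word_power v (n * m)) q"
  by (induction m) (auto simp: word_power_add path_append)

lemma path_power_diff:
  assumes "path S q (word_power v n) q" "path S q (word_power v (n + m)) q"
  shows "path S q (word_power v m) q"
  using assms path_unique by (auto simp: word_power_add path_append)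

text \<open>The exponents of powers of \<open>v\<close> that fix \<open>q\<close> are closed under
  multiples and differences, so Bezout's identity in its subtraction-free form applies.\<close>

lemma path_power_gcd:
  assumes "path S q (word_power v n) q" "path S q (word_power v m) q" "n \<ge> 1"
  shows "path S q (word_power v (gcd n m)) q"
proof -
  obtain x y where "n * x = m * y + gcd n m"
    using bezout_nat[of n m] assms(3) by auto
  then show ?thesis
    using path_power_mult[OF assms(1), of x] path_power_mult[OF assms(2), of y] path_power_diff
    by metis
qed

section \<open>The transition monoid in terms of paths\<close>

lemma step_iff: "step S p x = Some q \<longleftrightarrow> (p, x, q) \<in> edges S"
proof -
  have "(THE r. (p, x, r) \<in> edges S) = t" if "(p, x, t) \<in> edges S" for t
    using det that unfolding deterministic_def by blast
  then show ?thesis by (auto simp: step_def)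
qed

lemma run_iff: "run S w p = Some q \<longleftrightarrow> p \<in> verts S \<and> path S p w q"
  by (induction w arbitrary: p) (auto simp: bind_eq_Some_conv step_iff dest: edges_closed)

lemma run_append: "run S (u @ v) = (\<lambda>q. Option.bind (run S u q) (run S v))"
proof
  fix p
  have "run S (u @ v) p = Some q \<longleftrightarrow> Option.bind (run S u p) (run S v) = Some q" for q
    by (auto simp: run_iff bind_eq_Some_conv path_append dest: path_in_verts)
  then show "run S (u @ v) p = Option.bind (run S u p) (run S v)"
    by (metis not_None_eq)
qed

lemma transition_monoid_sel [simp]:
  "carrier (transition_monoid A S) = run S ` lists (letters A)"
  "\<one>\<^bsub>transition_monoid A S\<^esub> = run S []"
  "run S u \<otimes>\<^bsub>transition_monoid A S\<^esub> run S v = run S (u @ v)"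
  by (auto simp: transition_monoid_def run_append)

lemma monoid_transition_monoid: "monoid (transition_monoid A S)"
  by (rule monoidI) (auto intro!: imageI)

text \<open>A finite vertex set has only finitely many partial transformations; they are collected
  here by their domains.\<close>

lemma finite_transition_monoid: "finite (carrier (transition_monoid A S))"
proof -
  have "carrier (transition_monoid A S) \<subseteq> (\<Union>D\<in>Pow (verts S). {m. dom m = D \<and> ran m \<subseteq> verts S})"
    by (auto simp: dom_def ran_def run_iff dest: path_in_verts)
  then show ?thesis
    by (rule finite_subset) (auto intro!: finite_set_of_finite_maps finite_verts finite_subset[OF _ finite_verts])
qed

lemma pow_transition_monoid: "run S v [^]\<^bsub>transition_monoid A S\<^esub> (n::nat) = run S (word_power v n)"
proof (induction n)
  case (Suc n)
  have "word_power v (Suc n) = word_power v n @ v"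
    using word_power_add[of v n 1] by (simp add: word_power_Suc)
  with Suc show ?case by (simp add: nat_pow_def)
qed (simp add: nat_pow_def)

end

text \<open>Abstracts from folding: \<open>K\<close> enters only through its reduced words, which
  are the reduced labels of closed paths at the basepoint. An unreduced word with reduction in
  \<open>K\<close> may be unreadable.\<close>

locale stallings = det_inverse_automaton A S
  for A :: "'a set" and S :: "('q, 'a) automaton" +
  fixes K
  assumes K_subgroup: "subgroup K (free_group A)"
    and closed_path_iff: "w \<in> lists (letters A) \<Longrightarrow> reduced w \<Longrightarrow>
      path S (basepoint S) w (basepoint S) \<longleftrightarrow> w \<in> K"

text \<open>A closed path labelled \<open>w\<close> forces the coset of \<open>w\<close> to be
  \<open>K\<close>. Conversely, the generators label closed paths, and such labels are closed under
  concatenation, inversion and reduction.\<close>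

lemma stallings_automaton:
  assumes "is_stallings_automaton A K S"
  shows "stallings A S K"
proof -
  let ?G = "free_group A"
  interpret group ?G by (rule group_free_group)
  obtain us where us: "set us \<subseteq> carrier ?G" "generate ?G (set us) = K"
      "fold_step\<^sup>*\<^sup>* (flower us) S" "deterministic S"
    using assms unfolding is_stallings_automaton_def by blast
  have K: "subgroup K ?G" using us generate_is_subgroup by blast
  have usK: "set us \<subseteq> K" using us(2) generate.incl by fast
  obtain c where "coset_labelling A K (flower us) c"
    using coset_labelling_flower[OF us(1) K usK] by blast
  moreover have "inverse_automaton A (flower us)"
    using us(1) by (intro inverse_automaton_flower) auto
  ultimately have inv: "inverse_automaton A S" "coset_labelling A K S c"
    and petals: "\<And>u. u \<in> set us \<Longrightarrow> path S (basepoint S) u (basepoint S)"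
    using fold_steps_invariants[OF us(3)] path_flower unfolding basepoint_flower by blast+
  interpret det_inverse_automaton A S
    using inv(1) us(4) by (simp add: det_inverse_automaton_def det_inverse_automaton_axioms_def)
  have "w \<in> K" if w: "w \<in> lists (letters A)" "reduced w" "path S (basepoint S) w (basepoint S)" for w
  proof -
    have "K = K #>\<^bsub>?G\<^esub> w"
      using path_coset[OF inv(2) w(3,1)] inv(2) subgroup.subset[OF K] w(2)
      by (simp add: coset_labelling_def reduce_reduced)
    then show ?thesis using coset_join1[OF _ _ K, of w] subgroup.subset[OF K] w by simp
  qed
  moreover have "path S (basepoint S) w (basepoint S)" if "w \<in> K" for w
    using that[folded us(2)]
  proof (induction rule: generate.induct)
    case (inv h)
    then show ?case
      using us(1) petals path_reduce path_inv by (auto simp: inv_free_group subset_iff)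
  next
    case (eng u v)
    then show ?case by (auto simp: path_append intro!: path_reduce)
  qed (simp_all add: petals)
  ultimately have "stallings_axioms A S K"
    using K unfolding stallings_axioms_def by blast
  with det_inverse_automaton_axioms show ?thesis
    by (simp add: stallings_def)
qed


section \<open>Subgroups of finite monoids\<close>

text \<open>By the pigeonhole principle the powers are periodic from some exponent \<open>i\<close>
  on, with some period \<open>d\<close>; any positive multiple of \<open>d\<close> that is at least
  \<open>i\<close> gives an idempotent.\<close>

lemma (in monoid) ex_idempotent_power:
  assumes "finite (carrier G)" "x \<in> carrier G"
  shows "\<exists>N\<ge>1::nat. x [^] (N + N) = x [^] N"
proof -
  have "\<not> inj (\<lambda>n::nat. x [^] n)"
    using assms finite_subset[of "range (\<lambda>n::nat. x [^] n)" "carrier G"] finite_imageD by blast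
  then obtain i d :: nat where d: "d \<ge> 1" "x [^] i = x [^] (i + d)"
    unfolding inj_def by (metis add_diff_inverse_nat less_imp_le_nat linorder_neqE_nat not_less
      zero_less_diff less_one)
  have shift: "x [^] (i + t) = x [^] (i + t + d * s)" for t s
  proof (induction s)
    case (Suc s)
    have "x [^] (i + t + d * Suc s) = x [^] (i + d) \<otimes> x [^] (t + d * s)"
      using assms(2) by (simp add: nat_pow_mult algebra_simps)
    also have "\<dots> = x [^] (i + t + d * s)"
      unfolding d(2)[symmetric] using assms(2) by (simp add: nat_pow_mult algebra_simps)
    finally show ?case using Suc by simp
  qed simp
  \<comment> \<open>The factor \<open>Suc i\<close> makes \<open>N\<close> at least \<open>i\<close>
    and keeps it positive even for \<open>i = 0\<close>.\<close>
  define N where "N = d * Suc i"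
  have "i \<le> N" using d(1) unfolding N_def by (cases d) auto
  then have "x [^] (N + N) = x [^] N"
    using shift[of "N - i" "Suc i"] by (simp add: N_def)
  moreover have "N \<ge> 1" using d(1) by (simp add: N_def)
  ultimately show ?thesis by blast
qed

text \<open>The powers with exponent at least \<open>N\<close> form a group whose identity is the
  idempotent. Since \<open>x\<close> itself may lie outside it, the next power \<open>Suc N\<close>
  takes its place.\<close>

lemma ex_cyclic_subgroup:
  fixes M :: "'m monoid"
  assumes "monoid M" "finite (carrier M)" "x \<in> carrier M"
  shows "\<exists>H N. subgroup_of_monoid H M \<and> N \<ge> 1 \<and> \<one>\<^bsub>H\<^esub> = x [^]\<^bsub>M\<^esub> N \<and> x [^]\<^bsub>M\<^esub> Suc N \<in> carrier H \<and>
    x [^]\<^bsub>M\<^esub> (N + N) = x [^]\<^bsub>M\<^esub> N"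
proof -
  interpret monoid M by fact
  obtain N :: nat where N: "N \<ge> 1" "x [^]\<^bsub>M\<^esub> (N + N) = x [^]\<^bsub>M\<^esub> N"
    using ex_idempotent_power[OF assms(2,3)] by blast
  have unit: "x [^]\<^bsub>M\<^esub> (N + j) = x [^]\<^bsub>M\<^esub> j" if "j \<ge> N" for j
  proof -
    have "x [^]\<^bsub>M\<^esub> (N + j) = x [^]\<^bsub>M\<^esub> (N + N) \<otimes>\<^bsub>M\<^esub> x [^]\<^bsub>M\<^esub> (j - N)"
      using that assms(3) by (simp add: nat_pow_mult)
    then show ?thesis using that assms(3) N(2) by (simp add: nat_pow_mult)
  qed
  have mult: "x [^]\<^bsub>M\<^esub> (N * Suc j) = x [^]\<^bsub>M\<^esub> N" for j
    by (induction j) (simp_all add: unit N(2))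
  define H where "H = M\<lparr>carrier := {x [^]\<^bsub>M\<^esub> j | j. j \<ge> N}, one := x [^]\<^bsub>M\<^esub> N\<rparr>"
  have carrier_H: "carrier H = {x [^]\<^bsub>M\<^esub> j | j. j \<ge> N}"
    by (simp add: H_def)
  have "group H"
  proof (rule groupI)
    fix y assume "y \<in> carrier H"
    then obtain j where j: "j \<ge> N" "y = x [^]\<^bsub>M\<^esub> j" by (auto simp: H_def)
    \<comment> \<open>The exponents of \<open>?z\<close> and \<open>y\<close> add up to a multiple
      of \<open>N\<close>; the summand \<open>N\<close> keeps \<open>?z\<close> inside
      \<open>H\<close>.\<close>
    let ?z = "x [^]\<^bsub>M\<^esub> (N + (N - 1) * j)"
    have "N + (N - 1) * j + j = N * Suc j"
      using N(1) by (cases N) auto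
    then have "?z \<otimes>\<^bsub>M\<^esub> y = x [^]\<^bsub>M\<^esub> N"
      using assms(3) j(2) mult[of j] by (metis nat_pow_mult)
    moreover have "?z \<in> carrier H" unfolding H_def by auto
    ultimately show "\<exists>z\<in>carrier H. z \<otimes>\<^bsub>H\<^esub> y = \<one>\<^bsub>H\<^esub>"
      by (intro bexI[of _ ?z]) (simp_all add: H_def)
    show "\<one>\<^bsub>H\<^esub> \<otimes>\<^bsub>H\<^esub> y = y"
      using j assms(3) by (simp add: H_def nat_pow_mult unit)
  next
    fix y z assume "y \<in> carrier H" "z \<in> carrier H"
    then show "y \<otimes>\<^bsub>H\<^esub> z \<in> carrier H"
      using assms(3) by (auto simp: H_def nat_pow_mult intro: trans_le_add1)
  qed (use assms(3) in \<open>auto simp: H_def m_assoc\<close>)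
  moreover have "H = M\<lparr>carrier := carrier H, one := x [^]\<^bsub>M\<^esub> N\<rparr>" "carrier H \<subseteq> carrier M"
    using assms(3) by (auto simp: H_def)
  ultimately have "subgroup_of_monoid H M"
    unfolding subgroup_of_monoid_def by blast
  moreover have "\<one>\<^bsub>H\<^esub> = x [^]\<^bsub>M\<^esub> N" by (simp add: H_def)
  moreover have "x [^]\<^bsub>M\<^esub> Suc N \<in> carrier H"
    using le_SucI[OF order_refl, of N] unfolding carrier_H by blast
  ultimately show ?thesis using N by blast
qed

text \<open>Exponents are positive because the zeroth powers are the two identities, which may
  differ.\<close>

lemma pow_subgroup_of_monoid:
  assumes "monoid M" "subgroup_of_monoid H M" "x \<in> carrier H"
  shows "x [^]\<^bsub>H\<^esub> Suc n = x [^]\<^bsub>M\<^esub> Suc n"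
proof -
  obtain e where e: "carrier H \<subseteq> carrier M" "H = M\<lparr>carrier := carrier H, one := e\<rparr>" "group H"
    using assms(2) by (auto simp: subgroup_of_monoid_def)
  interpret M: monoid M by fact
  interpret H: group H by fact
  have mult: "(\<otimes>\<^bsub>H\<^esub>) = (\<otimes>\<^bsub>M\<^esub>)" by (subst e(2)) simp
  show ?thesis
  proof (induction n)
    case 0
    then show ?case using assms(3) e(1) by auto
  next
    case (Suc n)
    then show ?case
      using H.nat_pow_Suc[of x "Suc n"] M.nat_pow_Suc[of x "Suc n"] mult by metis
  qed
qed


section \<open>The equivalences\<close>

text \<open>A threshold can always be enlarged. The filter form allows finitely many thresholds to
  be combined.\<close>

lemma ex_ge_one_iff_eventually:
  "(\<exists>p\<ge>1::nat. \<forall>m\<ge>p. P m) \<longleftrightarrow> (\<forall>\<^sub>F m in at_top. P m)"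
  unfolding eventually_at_top_linorder by (meson le_trans nat_le_linear)

section \<open>Subgroups of the transition monoid and fixed vertices\<close>

context det_inverse_automaton
begin

text \<open>A vertex fixed by some power of \<open>v\<close> lies in the domain of the idempotent power
  \<open>v\<^sup>N\<close>; being a partial identity, the latter fixes that vertex.\<close>

lemma V_bar_imp_fixed:
  assumes "transition_monoid A S \<in> V_bar k" "\<And>n. n \<ge> 1 \<Longrightarrow> k n \<ge> 1" "v \<in> lists (letters A)"
  shows "\<forall>\<^sub>F m in at_top. \<forall>q n. n \<ge> 1 \<longrightarrow> run S (word_power v n) q = Some q \<longrightarrow>
    run S (word_power v (k m)) q = Some q"
proof -
  let ?M = "transition_monoid A S" and ?f = "run S v"
  interpret monoid ?M by (rule monoid_transition_monoid)
  have f: "?f \<in> carrier ?M" using assms(3) by auto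
  obtain H N where H: "subgroup_of_monoid H ?M" "N \<ge> 1" "\<one>\<^bsub>H\<^esub> = ?f [^]\<^bsub>?M\<^esub> N"
      "?f [^]\<^bsub>?M\<^esub> Suc N \<in> carrier H" "?f [^]\<^bsub>?M\<^esub> (N + N) = ?f [^]\<^bsub>?M\<^esub> N"
    using ex_cyclic_subgroup[OF monoid_transition_monoid finite_transition_monoid f] by blast
  obtain p where p: "p \<ge> 1" "\<And>m. m \<ge> p \<Longrightarrow> (?f [^]\<^bsub>?M\<^esub> Suc N) [^]\<^bsub>H\<^esub> k m = \<one>\<^bsub>H\<^esub>"
    using assms(1) H(1,4) unfolding V_bar_def V_def by blast
  have "run S (word_power v (k m)) q = Some q"
    if m: "m \<ge> p" and n: "n \<ge> 1" "run S (word_power v n) q = Some q" for m n q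
  proof -
    have "k m \<ge> 1" using assms(2)[of m] m p(1) by simp
    then obtain l where "k m = Suc l" by (cases "k m") auto
    then have "?f [^]\<^bsub>?M\<^esub> N = (?f [^]\<^bsub>?M\<^esub> Suc N) [^]\<^bsub>?M\<^esub> k m"
      using p(2)[OF m] pow_subgroup_of_monoid[OF monoid_transition_monoid H(1,4), of l] H(3) by metis
    then have eq: "run S (word_power v N) = run S (word_power v (Suc N * k m))"
      using nat_pow_pow[OF f] pow_transition_monoid by metis
    have idem: "run S (word_power v (N + N)) = run S (word_power v N)"
      using H(5) pow_transition_monoid by metis
    have q: "q \<in> verts S" "path S q (word_power v n) q" using n by (auto simp: run_iff)
    \<comment> \<open>The exponent equals \<open>n * N\<close>, written so that \<open>v^N\<close>
      is visibly a readable prefix.\<close>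
    have "path S q (word_power v (N + (n - 1) * N)) q"
      using path_power_mult[OF q(2), of N] n(1) by (simp add: algebra_simps flip: mult_Suc)
    then obtain r where r: "path S q (word_power v N) r"
      by (auto simp: word_power_add path_append)
    then have "path S q (word_power v (N + N)) r"
      using idem q(1) by (metis run_iff)
    then have "path S r (word_power v N) r"
      using r path_unique by (auto simp: word_power_add path_append)
    then have N: "path S q (word_power v N) q"
      using r path_injective by blast
    \<comment> \<open>The exponent is \<open>Suc N * k m\<close>. Since \<open>v^N\<close> fixes
      \<open>q\<close>, the part \<open>N * k m\<close> can be subtracted, leaving
      \<open>k m\<close>.\<close>
    then have "path S q (word_power v (N * k m + k m)) q"
      using eq q(1) by (metis run_iff add.commute mult_Suc)
    with path_power_mult[OF N] have "path S q (word_power v (k m)) q"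
      by (rule path_power_diff)
    then show ?thesis using q(1) by (simp add: run_iff)
  qed
  then show ?thesis
    unfolding eventually_at_top_linorder by blast
qed

lemma V_bar_iff_gcd:
  assumes "\<And>n. n \<ge> 1 \<Longrightarrow> k n \<ge> 1"
  shows "transition_monoid A S \<in> V_bar k \<longleftrightarrow>
    (\<exists>p\<ge>1. \<forall>q\<in>verts S. \<forall>v\<in>lists (letters A). \<forall>n\<ge>1. \<forall>m\<ge>p.
       run S (word_power v n) q = Some q \<longrightarrow> run S (word_power v (gcd n (k m))) q = Some q)"
    (is "?L \<longleftrightarrow> ?R")
proof
  let ?M = "transition_monoid A S"
  assume ?L
  \<comment> \<open>Quantifying over the finitely many transformations instead of the words yields a
    common threshold.\<close>
  have "\<forall>\<^sub>F m in at_top. \<forall>f\<in>carrier ?M. \<forall>q. \<forall>n::nat\<ge>1.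
      (f [^]\<^bsub>?M\<^esub> n) q = Some q \<longrightarrow> (f [^]\<^bsub>?M\<^esub> k m) q = Some q"
  proof (intro eventually_ball_finite[OF finite_transition_monoid] ballI)
    fix f assume "f \<in> carrier ?M"
    then obtain v where v: "v \<in> lists (letters A)" "f = run S v" by auto
    show "\<forall>\<^sub>F m in at_top. \<forall>q. \<forall>n::nat\<ge>1.
        (f [^]\<^bsub>?M\<^esub> n) q = Some q \<longrightarrow> (f [^]\<^bsub>?M\<^esub> k m) q = Some q"
      using V_bar_imp_fixed[OF \<open>?L\<close> assms v(1)] by (simp add: pow_transition_monoid v(2))
  qed
  then obtain p :: nat where "p \<ge> 1" and p: "\<forall>m\<ge>p. \<forall>f\<in>carrier ?M. \<forall>q. \<forall>n::nat\<ge>1.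
      (f [^]\<^bsub>?M\<^esub> n) q = Some q \<longrightarrow> (f [^]\<^bsub>?M\<^esub> k m) q = Some q"
    unfolding ex_ge_one_iff_eventually[symmetric] by (elim exE conjE)
  have "run S (word_power v (gcd n (k m))) q = Some q"
    if *: "m \<ge> p" "v \<in> lists (letters A)" "n \<ge> 1" "run S (word_power v n) q = Some q" for m v n q
  proof -
    have "run S v \<in> carrier ?M" using *(2) by auto
    then have "run S (word_power v (k m)) q = Some q"
      using p *(1,3,4) unfolding pow_transition_monoid[symmetric] by blast
    then show ?thesis
      using *(3,4) path_power_gcd by (simp add: run_iff)
  qed
  with \<open>p \<ge> 1\<close> show ?R by blast
next
  let ?M = "transition_monoid A S"
  assume ?R
  then obtain p where "p \<ge> 1" and p: "\<And>q v n m. q \<in> verts S \<Longrightarrow> v \<in> lists (letters A) \<Longrightarrow> n \<ge> 1 \<Longrightarrow>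
      m \<ge> p \<Longrightarrow> run S (word_power v n) q = Some q \<Longrightarrow> run S (word_power v (gcd n (k m))) q = Some q"
    by blast
  have "H \<in> V k" if H: "subgroup_of_monoid H ?M" for H
  proof -
    obtain e where e: "carrier H \<subseteq> carrier ?M" "H = ?M\<lparr>carrier := carrier H, one := e\<rparr>" "group H"
      using H by (auto simp: subgroup_of_monoid_def)
    interpret H: group H by fact
    have mult: "(\<otimes>\<^bsub>H\<^esub>) = (\<otimes>\<^bsub>?M\<^esub>)" by (subst e(2)) simp
    have fin: "finite (carrier H)" using e(1) finite_transition_monoid finite_subset by blast
    have "f [^]\<^bsub>H\<^esub> k m = \<one>\<^bsub>H\<^esub>" if m: "m \<ge> p" and f: "f \<in> carrier H" for m f
    proof -
      obtain v where v: "v \<in> lists (letters A)" "f = run S v" using e(1) f by auto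
      have powH: "f [^]\<^bsub>H\<^esub> n = run S (word_power v n)" if "n \<ge> 1" for n
        using pow_subgroup_of_monoid[OF monoid_transition_monoid H f, of "n - 1"] that
        by (simp add: v(2) pow_transition_monoid del: nat_pow_Suc)
      \<comment> \<open>The order of \<open>H\<close> serves as the exponent \<open>n\<close> of the
        assumption, since \<open>v^h\<close> acts as the identity of \<open>H\<close>.\<close>
      define h where "h = order H"
      define g where "g = gcd h (k m)"
      have h: "h \<ge> 1" unfolding h_def using fin H.order_gt_0_iff_finite by simp
      then have g: "g \<ge> 1" unfolding g_def by (simp add: Suc_le_eq)
      have one: "\<one>\<^bsub>H\<^esub> = run S (word_power v h)"
        using H.pow_order_eq_1[OF f] powH[OF h] by (simp add: h_def)
      have "\<one>\<^bsub>H\<^esub> \<otimes>\<^bsub>H\<^esub> \<one>\<^bsub>H\<^esub> = \<one>\<^bsub>H\<^esub>" by simp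
      then have idem: "run S (word_power v h @ word_power v h) = run S (word_power v h)"
        unfolding mult one by simp
      \<comment> \<open>An idempotent partial injection is a partial identity.\<close>
      have fixed: "r = q" if "run S (word_power v h) q = Some r" for q r
      proof -
        have "path S q (word_power v h @ word_power v h) r" "path S q (word_power v h) r"
          using that idem by (metis run_iff)+
        then show ?thesis
          unfolding path_append using path_unique path_injective by metis
      qed
      \<comment> \<open>This confines the domain of \<open>f^g\<close> to that of the identity of
        \<open>H\<close>.\<close>
      have "\<one>\<^bsub>H\<^esub> \<otimes>\<^bsub>H\<^esub> f [^]\<^bsub>H\<^esub> g = f [^]\<^bsub>H\<^esub> g" using f by simp
      then have hg: "run S (word_power v h @ word_power v g) = run S (word_power v g)"
        unfolding mult one powH[OF g] by simp
      have "run S (word_power v g) q = run S (word_power v h) q" for q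
      proof (cases "run S (word_power v h) q")
        case None
        then have "run S (word_power v h @ word_power v g) q = None"
          by (simp add: run_append)
        then show ?thesis using hg None by simp
      next
        case (Some r)
        then have "run S (word_power v h) q = Some q" using fixed by blast
        moreover from this have "run S (word_power v g) q = Some q"
          unfolding g_def using p[of q v h m] v(1) h m by (simp add: run_iff)
        ultimately show ?thesis by simp
      qed
      then have "f [^]\<^bsub>H\<^esub> g = \<one>\<^bsub>H\<^esub>" using one powH[OF g] by auto
      moreover obtain l where "k m = g * l" unfolding g_def by (meson dvdE gcd_dvd2)
      ultimately show ?thesis using H.nat_pow_pow[OF f, of g l] by simp
    qed
    then show ?thesis using fin e(3) \<open>p \<ge> 1\<close> unfolding V_def by blast
  qed
  then show ?L
    using monoid_transition_monoid finite_transition_monoid by (simp add: V_bar_def)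
qed

end

section \<open>Passing between vertices and elements of \<open>K\<close>\<close>

context stallings
begin

lemma reduce_in_K:
  assumes "path S (basepoint S) w (basepoint S)"
  shows "reduce w \<in> K"
  using assms path_reduce path_in_lists closed_path_iff reduced_reduce by metis

text \<open>With \<open>x = z y z^-1\<close> and \<open>y\<close> cyclically reduced, the reduced
  form of \<open>x^n\<close> can be read from the basepoint, so \<open>y^n\<close> fixes the vertex
  reached by \<open>z\<close>. The transfer to \<open>y^g\<close> happens there.\<close>

lemma fixed_power_imp_power_in_K:
  assumes transfer: "\<And>q v. q \<in> verts S \<Longrightarrow> v \<in> lists (letters A) \<Longrightarrow>
      path S q (word_power v n) q \<Longrightarrow> path S q (word_power v g) q"
    and x: "x \<in> carrier (free_group A)" "x [^]\<^bsub>free_group A\<^esub> n \<in> K" and n: "n \<ge> 1"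
  shows "x [^]\<^bsub>free_group A\<^esub> g \<in> K"
proof (cases "x = []")
  case True
  interpret group "free_group A" by (rule group_free_group)
  have "x [^]\<^bsub>free_group A\<^esub> g = \<one>\<^bsub>free_group A\<^esub>"
    using True nat_pow_one[of g] by simp
  then show ?thesis using subgroup.one_closed[OF K_subgroup] by simp
next
  case False
  have red: "reduced x" using x(1) by simp
  obtain z y where zy: "x = z @ y @ inv_word z" "y \<noteq> []" "reduced (y @ y)"
    using cyclic_reduction[OF red False] by blast
  have pow: "x [^]\<^bsub>free_group A\<^esub> i = reduce (z @ word_power y i @ inv_word z)" for i :: nat
    using pow_free_group[of A x i] reduce_conj_power[of z y i] zy(1) red by (simp add: reduce_reduced)
  have "reduced (z @ word_power y n @ inv_word z)"
    using reduced_conj_power[OF _ zy(3,2) n, of z] red zy(1) by simp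
  then have "z @ word_power y n @ inv_word z \<in> K"
    using x(2) by (simp add: pow reduce_reduced)
  moreover have y: "y \<in> lists (letters A)" and "z @ word_power y n @ inv_word z \<in> lists (letters A)"
    using x(1) zy(1) word_power_in_lists[of y "letters A" n] by simp_all
  ultimately have "path S (basepoint S) (z @ word_power y n @ inv_word z) (basepoint S)"
    using closed_path_iff \<open>reduced (z @ _)\<close> by simp
  then obtain q r where qr: "path S (basepoint S) z q" "path S q (word_power y n) r"
      "path S r (inv_word z) (basepoint S)"
    by (auto simp: path_append)
  \<comment> \<open>Both \<open>q\<close> and \<open>r\<close> are led to the basepoint by
    \<open>inv_word z\<close>.\<close>
  have "r = q" using qr path_inv[of "basepoint S" z q] path_injective by blast
  then have "path S q (word_power y g) q"
    using transfer[OF path_in_verts[OF qr(1) basepoint_in] y] qr(2) by blast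
  then have "path S (basepoint S) (z @ word_power y g @ inv_word z) (basepoint S)"
    using qr \<open>r = q\<close> by (auto simp: path_append)
  then show ?thesis unfolding pow by (rule reduce_in_K)
qed

text \<open>Reading \<open>u v\<^sup>g u\<^sup>-\<^sup>1\<close> from the basepoint might get stuck although its reduction is in \<open>K\<close>.
  But \<open>u v\<^sup>g\<close> can be read since \<open>g \<le> n\<close>, and it has the same reduction as \<open>w u\<close> for some \<open>w \<in> K\<close>.\<close>

lemma power_in_K_imp_fixed_power:
  assumes transfer: "\<And>x. x \<in> carrier (free_group A) \<Longrightarrow>
      x [^]\<^bsub>free_group A\<^esub> n \<in> K \<Longrightarrow> x [^]\<^bsub>free_group A\<^esub> g \<in> K"
    and q: "q \<in> verts S" "path S q (word_power v n) q"
    and v: "v \<in> lists (letters A)" and g: "g \<le> n"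
  shows "path S q (word_power v g) q"
proof -
  let ?b = "basepoint S"
  obtain u where u: "path S ?b u q" using connected[OF q(1)] by blast
  define x where "x = reduce (u @ v @ inv_word u)"
  have pow: "x [^]\<^bsub>free_group A\<^esub> i = reduce (u @ word_power v i @ inv_word u)" for i :: nat
    unfolding x_def pow_free_group reduce_conj_power ..
  have "path S ?b (u @ word_power v n @ inv_word u) ?b"
    using u q(2) path_inv[OF u] by (auto simp: path_append)
  then have "x [^]\<^bsub>free_group A\<^esub> n \<in> K" unfolding pow by (rule reduce_in_K)
  moreover have "x \<in> carrier (free_group A)"
    using v path_in_lists[OF u] inv_word_in_lists[OF path_in_lists[OF u]] unfolding x_def
    by (auto intro!: reduce_in_lists)
  ultimately have w: "x [^]\<^bsub>free_group A\<^esub> g \<in> K" by (intro transfer)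
  then have "path S ?b (x [^]\<^bsub>free_group A\<^esub> g) ?b"
    using closed_path_iff[of "x [^]\<^bsub>free_group A\<^esub> g"] subgroup.subset[OF K_subgroup] by auto
  then have "path S ?b (reduce (x [^]\<^bsub>free_group A\<^esub> g @ u)) q"
    using u by (intro path_reduce) (auto simp: path_append)
  also have "reduce (x [^]\<^bsub>free_group A\<^esub> g @ u) = reduce ((u @ word_power v g) @ inv_word u @ u)"
    by (simp add: pow reduce_append_reduce_left)
  also have "\<dots> = reduce (u @ word_power v g)"
    using reduce_append_reduce_right[of "u @ word_power v g" "inv_word u @ u"]
    by (simp add: reduce_inv_word)
  finally have wu: "path S ?b (reduce (u @ word_power v g)) q" .
  obtain r where r: "path S q (word_power v g) r"
    using q(2) word_power_add[of v g "n - g"] g by (auto simp: path_append)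
  then have "path S ?b (reduce (u @ word_power v g)) r"
    using u by (intro path_reduce) (auto simp: path_append)
  then show ?thesis using wu r path_unique by blast
qed

text \<open>The same threshold works on both sides. Of the gcd only the bound
  \<open>g n m \<le> n\<close> enters: it makes \<open>v^g\<close> a prefix of the readable word
  \<open>v^n\<close>.\<close>

lemma fixed_power_iff_power_in_K:
  fixes g :: "nat \<Rightarrow> nat \<Rightarrow> nat"
  assumes "\<And>n m. n \<ge> 1 \<Longrightarrow> g n m \<le> n"
  shows "(\<exists>p\<ge>1. \<forall>q\<in>verts S. \<forall>v\<in>lists (letters A). \<forall>n\<ge>1. \<forall>m\<ge>p.
       run S (word_power v n) q = Some q \<longrightarrow> run S (word_power v (g n m)) q = Some q) \<longleftrightarrow>
    (\<exists>p\<ge>1. \<forall>x\<in>carrier (free_group A). \<forall>n::nat\<ge>1. \<forall>m\<ge>p.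
       x [^]\<^bsub>free_group A\<^esub> n \<in> K \<longrightarrow> x [^]\<^bsub>free_group A\<^esub> g n m \<in> K)"
  (is "(\<exists>p\<ge>1. ?P p) \<longleftrightarrow> (\<exists>p\<ge>1. ?Q p)")
proof -
  have "?P p \<longleftrightarrow> ?Q p" for p
  proof
    assume P: "?P p"
    show "?Q p"
    proof (intro ballI allI impI)
      fix x n m
      assume *: "x \<in> carrier (free_group A)" "1 \<le> n" "p \<le> m" "x [^]\<^bsub>free_group A\<^esub> (n::nat) \<in> K"
      show "x [^]\<^bsub>free_group A\<^esub> g n m \<in> K"
        by (rule fixed_power_imp_power_in_K[OF _ *(1,4,2)]) (use P *(2,3) in \<open>simp add: run_iff\<close>)
    qed
  next
    assume Q: "?Q p"
    show "?P p"
    proof (intro ballI allI impI)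
      fix q v n m
      assume *: "q \<in> verts S" "v \<in> lists (letters A)" "1 \<le> n" "p \<le> m"
        "run S (word_power v n) q = Some q"
      have "path S q (word_power v (g n m)) q"
        by (rule power_in_K_imp_fixed_power[where n = n])
          (use Q * assms in \<open>simp_all add: run_iff del: free_group_sel\<close>)
      then show "run S (word_power v (g n m)) q = Some q" using *(1) by (simp add: run_iff)
    qed
  qed
  then show ?thesis by simp
qed

end

theorem theorem5p6:
  fixes A :: "'a set" and K :: "'a letter list set"
    and S :: "(flower_vertex, 'a) automaton" and k :: "nat \<Rightarrow> nat"
  assumes "finite A"
    and "finitely_generated_subgroup (free_group A) K"
    and "is_stallings_automaton A K S"
    and "\<And>n. n \<ge> 1 \<Longrightarrow> k n \<ge> 1"
  shows "(transition_monoid A S \<in> V_bar k \<longleftrightarrow>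
           (\<exists>p\<ge>1. \<forall>q\<in>verts S. \<forall>v\<in>lists (letters A). \<forall>n\<ge>1. \<forall>m\<ge>p.
              run S (word_power v n) q = Some q \<longrightarrow>
              run S (word_power v (gcd n (k m))) q = Some q))
       \<and> (transition_monoid A S \<in> V_bar k \<longleftrightarrow>
           (\<exists>p\<ge>1. \<forall>x\<in>carrier (free_group A). \<forall>n::nat\<ge>1. \<forall>m\<ge>p.
              x [^]\<^bsub>free_group A\<^esub> n \<in> K \<longrightarrow>
              x [^]\<^bsub>free_group A\<^esub> (gcd n (k m)) \<in> K))"
proof -
  interpret stallings A S K using assms(3) by (rule stallings_automaton)
  note vertices = V_bar_iff_gcd[OF assms(4)]
  \<comment> \<open>For \<open>n = 0\<close> the gcd would be \<open>k m\<close>, so positivity of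
    \<open>n\<close> matters.\<close>
  have "gcd n (k m) \<le> n" if "n \<ge> 1" for n m
    using that by (simp add: Suc_le_eq)
  then show ?thesis
    by (intro conjI[OF vertices] trans[OF vertices] fixed_power_iff_power_in_K)
qed

end
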